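(* The following series identity holds: $$\sum_{k=0}^{\infty}\frac{2+3k}{(-8)^k}\,\frac{(1)_k^3}{(\frac{3}{2})_k^3}\left\{H_{1+2k}^{(2)}-\frac{5}{4}H_{k}^{(2)}\right\}=2\beta(4).$$
   Context: For a complex number $x$ and a nonnegative integer $n$, the shifted factorial is $(x)_0=1$ and $(x)_n=x(x+1)\cdots(x+n-1)$ for $n\ge 1$; $(x)_n^m$ denotes $((x)_n)^m$. The harmonic numbers of order 2 are $H_n^{(2)}=\sum_{j=1}^n \frac{1}{j^2}$, with $H_0^{(2)}=0$. The constant $\beta(4)$ is $\beta(4)=\sum_{k=0}^{\infty}\frac{(-1)^k}{(1+2k)^4}$. *)

theory Defs
  imports "HOL-Analysis.Analysis"
begin

definition harm2 :: "nat \<Rightarrow> real" where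
  "harm2 n = (\<Sum>j=1..n. 1 / (real j)^2)"

definition beta4 :: real where
  "beta4 = (\<Sum>k. (-1)^k / (1 + 2 * real k)^4)"

end

theory Submission
  imports Defs
begin

text \<open>
  Since \<open>harm2 (1 + 2 * k) - 5/4 * harm2 k\<close> is the sum of \<open>1/(2j+1)^2\<close> over \<open>j \<le> k\<close> minus
  \<open>harm2 k\<close>, the series is the derivative at \<open>y = 0\<close> of the series whose \<open>k\<close>-th term is the summand
  without harmonic numbers times \<open>\<Prod>j=1..k. (1 - y/j^2)\<close> over \<open>\<Prod>j\<le>k. (1 - y/(2j+1)^2)\<close>. For this series there is a WZ pair
  \<open>F m k - F (m+1) k = G m k - G m (k+1)\<close> with \<open>F 0 k = 2 (-1)^k / ((2k+1)^2 - y)\<close> in which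
  \<open>G m 0\<close> combines two consecutive terms, of indices \<open>2m\<close> and \<open>2m+1\<close>. The pair is differentiated termwise
  at \<open>y = 0\<close> and then summed, so that no interchange of derivative and series is needed; the remainder
  \<open>\<Sum>k. F' M k\<close> is \<open>O((1/4)^M)\<close>.
\<close>

section \<open>Quotients of cubic products and their derivatives at \<open>y = 0\<close>\<close>

text \<open>This is \<open>x^3 * (1 - y / x^2)\<close> without the division: the identities in
  \<open>y\<close> become polynomial ones, and products at \<open>y = 0\<close> are plain
  cubes.\<close>

definition cub :: "real \<Rightarrow> real \<Rightarrow> real" where
  "cub y x = x * (x^2 - y)"

definition quot :: "('a \<Rightarrow> real) \<Rightarrow> 'a set \<Rightarrow> ('b \<Rightarrow> real) \<Rightarrow> 'b set \<Rightarrow> real \<Rightarrow> real" where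
  "quot f I g J y = (\<Prod>i\<in>I. cub y (f i)) / (\<Prod>j\<in>J. cub y (g j))"

text \<open>Derivative of \<open>quot\<close> at 0 by logarithmic differentiation:
  \<open>cub y x\<close> has logarithmic derivative \<open>- 1 / x^2\<close> there. This is where
  second-order harmonic sums arise.\<close>

definition quot' :: "('a \<Rightarrow> real) \<Rightarrow> 'a set \<Rightarrow> ('b \<Rightarrow> real) \<Rightarrow> 'b set \<Rightarrow> real" where
  "quot' f I g J = quot f I g J 0 * ((\<Sum>j\<in>J. 1 / (g j)^2) - (\<Sum>i\<in>I. 1 / (f i)^2))"

lemma cub_0: "cub 0 x = x ^ 3"
  by (simp add: cub_def power2_eq_square power3_eq_cube)

lemma has_real_derivative_prod_cub:
  assumes "finite I" "\<And>i. i \<in> I \<Longrightarrow> f i \<noteq> 0"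
  shows "((\<lambda>y. \<Prod>i\<in>I. cub y (f i)) has_real_derivative
          - (\<Prod>i\<in>I. cub 0 (f i)) * (\<Sum>i\<in>I. 1 / (f i)^2)) (at 0)"
  using assms
proof (induction I)
  case (insert i I)
  have "((\<lambda>y. cub y (f i) * (\<Prod>i\<in>I. cub y (f i))) has_real_derivative
          (- f i) * (\<Prod>i\<in>I. cub 0 (f i))
          + (- (\<Prod>i\<in>I. cub 0 (f i)) * (\<Sum>i\<in>I. 1 / (f i)^2)) * cub 0 (f i)) (at 0)"
    using insert by (intro DERIV_mult) (auto simp: cub_def intro!: derivative_eq_intros)
  moreover have "- f i = - cub 0 (f i) * (1 / (f i)^2)"
    using insert.prems[of i] by (simp add: cub_def)
  ultimately show ?case
    using insert.hyps by (simp add: algebra_simps)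
qed auto

lemma has_real_derivative_quot:
  assumes "finite I" "\<And>i. i \<in> I \<Longrightarrow> f i \<noteq> 0" "finite J" "\<And>j. j \<in> J \<Longrightarrow> g j \<noteq> 0"
  shows "(quot f I g J has_real_derivative quot' f I g J) (at 0)"
proof -
  have nz: "(\<Prod>j\<in>J. cub 0 (g j)) \<noteq> 0"
    using assms by (simp add: cub_0)
  have "((\<lambda>y. (\<Prod>i\<in>I. cub y (f i)) / (\<Prod>j\<in>J. cub y (g j))) has_real_derivative quot' f I g J) (at 0)"
    using nz assms
    by (intro DERIV_cong[OF DERIV_divide[OF has_real_derivative_prod_cub has_real_derivative_prod_cub]])
       (auto simp: quot'_def quot_def field_simps)
  thus ?thesis by (simp add: quot_def[abs_def])
qed

section \<open>The WZ pair, the deformed series and their derivatives\<close>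

text \<open>Both ends of the denominator range stay free because \<open>wz_F\<close> takes
  \<open>m + 1\<close> odd factors, \<open>wz_G\<close> takes \<open>m + 2\<close>, and shifting
  \<open>m\<close> or \<open>k\<close> moves the ends.\<close>

definition wz_quot :: "nat \<Rightarrow> nat \<Rightarrow> nat \<Rightarrow> real \<Rightarrow> real" where
  "wz_quot m a b = quot (\<lambda>j. 2 * real j) {1..m} (\<lambda>j. 2 * real j + 1) {a..<b}"

definition wz_quot' :: "nat \<Rightarrow> nat \<Rightarrow> nat \<Rightarrow> real" where
  "wz_quot' m a b = quot' (\<lambda>j. 2 * real j) {1..m} (\<lambda>j. 2 * real j + 1) {a..<b}"

definition wz_F :: "nat \<Rightarrow> nat \<Rightarrow> real \<Rightarrow> real" where
  "wz_F m k y = 2 * (-1)^k * (1 + 3 * real m + 2 * real k) * wz_quot m (m + k) (2 * m + k + 1) y"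

definition wz_F' :: "nat \<Rightarrow> nat \<Rightarrow> real" where
  "wz_F' m k = 2 * (-1)^k * (1 + 3 * real m + 2 * real k) * wz_quot' m (m + k) (2 * m + k + 1)"

text \<open>
  The certificate polynomial \<open>N0 - y N1\<close> was found by solving the linear system that \<open>wz_numerator\<close>
  below imposes on its coefficients.
\<close>

definition wz_N0 :: "real \<Rightarrow> real \<Rightarrow> real" where
  "wz_N0 m k = 49 + 184 * k + 216 * k^2 + 96 * k^3 + 16 * k^4
     + 342 * m + 876 * m * k + 648 * m * k^2 + 144 * m * k^3
     + 840 * m^2 + 1344 * m^2 * k + 480 * m^2 * k^2 + 880 * m^3 + 672 * m^3 * k + 336 * m^4"

definition wz_N1 :: "real \<Rightarrow> real \<Rightarrow> real" where
  "wz_N1 m k = 1 + 4 * k + 4 * k^2 + 10 * m + 12 * m * k + 12 * m^2"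

definition wz_G :: "nat \<Rightarrow> nat \<Rightarrow> real \<Rightarrow> real" where
  "wz_G m k y = (-1)^k * (wz_N0 m k - y * wz_N1 m k) * wz_quot m (m + k) (2 * m + k + 2) y"

text \<open>The \<open>wz_N1\<close> term is the product rule applied to the certificate, which is
  linear in \<open>y\<close>.\<close>

definition wz_G' :: "nat \<Rightarrow> nat \<Rightarrow> real" where
  "wz_G' m k = (-1)^k * (wz_N0 m k * wz_quot' m (m + k) (2 * m + k + 2)
                 - wz_N1 m k * wz_quot m (m + k) (2 * m + k + 2) 0)"

text \<open>The odd product contains the powers of 2 that turn \<open>(-1)^n\<close> into
  \<open>1 / (-8)^n\<close> at \<open>y = 0\<close>. The index \<open>j = 0\<close> contributes the
  factor \<open>1 - y\<close>, hence the term 1 of the odd harmonic sum.\<close>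

definition ser :: "nat \<Rightarrow> real \<Rightarrow> real" where
  "ser n y = (-1)^n * (3 * real n + 2) * quot real {1..n} (\<lambda>j. 2 * real j + 1) {..n} y"

definition ser' :: "nat \<Rightarrow> real" where
  "ser' n = (-1)^n * (3 * real n + 2) * quot' real {1..n} (\<lambda>j. 2 * real j + 1) {..n}"

lemma wz_quot_deriv: "(wz_quot m a b has_real_derivative wz_quot' m a b) (at 0)"
  unfolding wz_quot_def wz_quot'_def
proof (rule has_real_derivative_quot)
  show "2 * real j + 1 \<noteq> 0" for j
    using of_nat_0_le_iff[of j] by linarith
qed auto

lemma wz_F_deriv: "(wz_F m k has_real_derivative wz_F' m k) (at 0)"
  unfolding wz_F_def[abs_def] wz_F'_def by (intro DERIV_cmult wz_quot_deriv)

lemma ser_deriv: "(ser n has_real_derivative ser' n) (at 0)"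
  unfolding ser_def[abs_def] ser'_def
proof (intro DERIV_cmult has_real_derivative_quot)
  show "2 * real j + 1 \<noteq> 0" for j
    using of_nat_0_le_iff[of j] by linarith
qed auto

lemma wz_G_deriv: "(wz_G m k has_real_derivative wz_G' m k) (at 0)"
  unfolding wz_G_def[abs_def] wz_G'_def
  by (auto intro!: derivative_eq_intros wz_quot_deriv simp: algebra_simps)

section \<open>The WZ equation and its boundary value at \<open>k = 0\<close>\<close>

lemma cub_odd_nonzero:
  assumes "\<bar>y\<bar> < 1"
  shows "cub y (2 * real j + 1) \<noteq> 0"
proof -
  have "(2 * real j + 1)^2 \<ge> 1" by (intro one_le_power) simp
  hence "(2 * real j + 1)^2 - y \<noteq> 0" using assms by linarith
  moreover have "2 * real j + 1 \<noteq> 0" using of_nat_0_le_iff[of j] by linarith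
  ultimately show ?thesis by (simp add: cub_def)
qed

lemma wz_quot_Suc_m: "wz_quot (Suc m) a b y = wz_quot m a b y * cub y (2 * real m + 2)"
  by (simp add: wz_quot_def quot_def algebra_simps)

lemma wz_quot_Suc_right:
  "a \<le> b \<Longrightarrow> wz_quot m a (Suc b) y = wz_quot m a b y / cub y (2 * real b + 1)"
  by (simp add: wz_quot_def quot_def)

lemma wz_quot_left:
  "a < b \<Longrightarrow> wz_quot m a b y = wz_quot m (Suc a) b y / cub y (2 * real a + 1)"
  by (simp add: wz_quot_def quot_def prod.atLeast_Suc_lessThan)

text \<open>The WZ equation with denominators cleared. The plus sign on the right comes from
  \<open>(-1)^(k+1)\<close> in the shifted certificate term.\<close>

lemma wz_numerator:
  "2 * (1 + 3 * m + 2 * k) * cub y (4 * m + 2 * k + 3) * cub y (4 * m + 2 * k + 5)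
   - 2 * (4 + 3 * m + 2 * k) * cub y (2 * m + 2) * cub y (2 * m + 2 * k + 1)
   = (wz_N0 m k - y * wz_N1 m k) * cub y (4 * m + 2 * k + 5)
     + (wz_N0 m (k + 1) - y * wz_N1 m (k + 1)) * cub y (2 * m + 2 * k + 1)"
  unfolding cub_def wz_N0_def wz_N1_def by algebra

lemma wz_pair:
  assumes "\<bar>y\<bar> < 1"
  shows "wz_F m k y - wz_F (Suc m) k y = wz_G m k y - wz_G m (Suc k) y"
proof -
  \<comment> \<open>\<open>W\<close> is the part common to all four terms; \<open>p0\<close>,
    \<open>p1\<close>, \<open>p2\<close> are the odd factors with indices \<open>m + k\<close>,
    \<open>2 * m + k + 1\<close>, \<open>2 * m + k + 2\<close>, in which the terms differ.\<close>
  define W where "W = wz_quot m (Suc (m + k)) (2 * m + k + 1) y"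
  define p0 where "p0 = cub y (2 * real m + 2 * real k + 1)"
  define p1 where "p1 = cub y (4 * real m + 2 * real k + 3)"
  define p2 where "p2 = cub y (4 * real m + 2 * real k + 5)"
  have nz: "p0 \<noteq> 0" "p1 \<noteq> 0" "p2 \<noteq> 0"
    using cub_odd_nonzero[OF assms, of "m + k"] cub_odd_nonzero[OF assms, of "2 * m + k + 1"]
      cub_odd_nonzero[OF assms, of "2 * m + k + 2"]
    by (simp_all add: p0_def p1_def p2_def algebra_simps)
  have s1: "2 * real (2 * m + k + 1) + 1 = 4 * real m + 2 * real k + 3"
    and s2: "2 * real (2 * m + k + 2) + 1 = 4 * real m + 2 * real k + 5"
    and s0: "2 * real (m + k) + 1 = 2 * real m + 2 * real k + 1" by simp_all
  have q1: "wz_quot m (m + k) (2 * m + k + 1) y = W / p0"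
    unfolding W_def p0_def s0[symmetric] by (rule wz_quot_left) simp
  have q2: "wz_quot m (m + k) (2 * m + k + 2) y = W / p0 / p1"
    using wz_quot_Suc_right[of "m + k" "2 * m + k + 1" m y] unfolding q1 s1 p1_def by simp
  have q3: "wz_quot m (Suc (m + k)) (2 * m + k + 2) y = W / p1"
    using wz_quot_Suc_right[of "Suc (m + k)" "2 * m + k + 1" m y] unfolding s1 p1_def W_def by simp
  have q4: "wz_quot m (Suc (m + k)) (2 * m + k + 3) y = W / p1 / p2"
    using wz_quot_Suc_right[of "Suc (m + k)" "2 * m + k + 2" m y] unfolding q3 s2 p2_def
    by (simp add: numeral_3_eq_3)
  have F1: "wz_F m k y = 2 * (-1)^k * (1 + 3 * real m + 2 * real k) * (W / p0)"
    unfolding wz_F_def q1 ..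
  have F2: "wz_F (Suc m) k y =
      2 * (-1)^k * (4 + 3 * real m + 2 * real k) * (W / p1 / p2 * cub y (2 * real m + 2))"
    using q4 unfolding wz_F_def wz_quot_Suc_m by (simp add: eval_nat_numeral add_ac)
  have G1: "wz_G m k y = (-1)^k * (wz_N0 m k - y * wz_N1 m k) * (W / p0 / p1)"
    unfolding wz_G_def q2 ..
  have G2: "wz_G m (Suc k) y = - ((-1)^k * (wz_N0 m (real k + 1) - y * wz_N1 m (real k + 1)) * (W / p1 / p2))"
    using q4 unfolding wz_G_def by (simp add: eval_nat_numeral add_ac)
  have "wz_F m k y - wz_F (Suc m) k y = (-1)^k * W / (p0 * p1 * p2) *
      (2 * (1 + 3 * real m + 2 * real k) * p1 * p2
       - 2 * (4 + 3 * real m + 2 * real k) * cub y (2 * real m + 2) * p0)"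
    unfolding F1 F2 using nz by (simp add: field_simps)
  also have "\<dots> = (-1)^k * W / (p0 * p1 * p2) *
      ((wz_N0 m k - y * wz_N1 m k) * p2
       + (wz_N0 m (real k + 1) - y * wz_N1 m (real k + 1)) * p0)"
    unfolding p0_def p1_def p2_def wz_numerator ..
  also have "\<dots> = wz_G m k y - wz_G m (Suc k) y"
    unfolding G1 G2 using nz by (simp add: field_simps)
  finally show ?thesis .
qed

text \<open>Separates even from odd bases, so that the odd ones cancel against the first
  \<open>m\<close> denominators of \<open>ser (2 * m)\<close>.\<close>

lemma prod_cub_split:
  "(\<Prod>j\<in>{1..2*m}. cub y (real j)) =
   (\<Prod>j\<in>{1..m}. cub y (2 * real j)) * (\<Prod>j<m. cub y (2 * real j + 1))"
  by (induction m) (simp_all add: algebra_simps)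

text \<open>Once the odd factors \<open>B\<close> cancel, all three terms are multiples of
  \<open>A / (C * p1)\<close>, and the claim reduces to the polynomial identity
  \<open>N\<close>.\<close>

lemma wz_G_0:
  assumes "\<bar>y\<bar> < 1"
  shows "wz_G m 0 y = ser (2 * m) y + ser (Suc (2 * m)) y"
proof -
  define B where "B = (\<Prod>j<m. cub y (2 * real j + 1))"
  define C where "C = (\<Prod>j\<in>{m..2*m}. cub y (2 * real j + 1))"
  define A where "A = (\<Prod>j\<in>{1..m}. cub y (2 * real j))"
  define p0 where "p0 = cub y (2 * real m + 1)"
  define p1 where "p1 = cub y (4 * real m + 3)"
  have p1: "p1 \<noteq> 0" using cub_odd_nonzero[OF assms, of "2 * m + 1"] by (simp add: p1_def algebra_simps)
  have B: "B \<noteq> 0" and C: "C \<noteq> 0" using cub_odd_nonzero[OF assms] by (auto simp: B_def C_def)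
  have "{..2*m} = {..<m} \<union> {m..2*m}" by auto
  hence BC: "(\<Prod>j\<le>2*m. cub y (2 * real j + 1)) = B * C"
    unfolding B_def C_def by (simp add: prod.union_disjoint ivl_disj_int)
  have e: "ser (2*m) y = (6 * real m + 2) * (A * B / (B * C))"
    unfolding ser_def quot_def BC prod_cub_split A_def B_def by simp
  have o: "ser (Suc (2*m)) y = - ((6 * real m + 5) * (A * B * p0 / (B * C * p1)))"
    using BC prod_cub_split[of y m]
    by (simp add: ser_def quot_def A_def B_def p0_def p1_def algebra_simps)
  have q: "wz_quot m m (2*m+2) y = A / (C * p1)"
    by (simp add: wz_quot_def quot_def A_def C_def p1_def algebra_simps atLeastLessThanSuc_atLeastAtMost)
  have N: "wz_N0 m 0 - y * wz_N1 m 0 = (6 * real m + 2) * p1 - (6 * real m + 5) * p0"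
    unfolding wz_N0_def wz_N1_def p0_def p1_def cub_def
    by (simp add: algebra_simps power2_eq_square power3_eq_cube power4_eq_xxxx)
  have "wz_G m 0 y = ((6 * real m + 2) * p1 - (6 * real m + 5) * p0) * (A / (C * p1))"
    using q N by (simp add: wz_G_def)
  also have "\<dots> = ser (2 * m) y + ser (Suc (2 * m)) y"
    unfolding e o using p1 B C by (simp add: field_simps)
  finally show ?thesis .
qed

section \<open>Passing to derivatives at \<open>y = 0\<close>\<close>

text \<open>Transfers identities valid for \<open>\<bar>y\<bar> < 1\<close> to the primed quantities
  without expanding any derivative.\<close>

lemma deriv_eq_near_0:
  fixes f g :: "real \<Rightarrow> real"
  assumes "(f has_real_derivative f') (at 0)" "(g has_real_derivative g') (at 0)"
    and "\<And>y. \<bar>y\<bar> < 1 \<Longrightarrow> f y = g y"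
  shows "f' = g'"
proof (rule DERIV_unique)
  show "(f has_real_derivative g') (at 0)"
    by (rule has_field_derivative_transform_within[OF assms(2), of 1]) (use assms(3) in auto)
qed fact

lemma wz_pair': "wz_F' m k - wz_F' (Suc m) k = wz_G' m k - wz_G' m (Suc k)"
  by (rule deriv_eq_near_0[OF DERIV_diff[OF wz_F_deriv wz_F_deriv] DERIV_diff[OF wz_G_deriv wz_G_deriv]])
     (rule wz_pair)

lemma wz_G'_0: "wz_G' m 0 = ser' (2 * m) + ser' (Suc (2 * m))"
  by (rule deriv_eq_near_0[OF wz_G_deriv DERIV_add[OF ser_deriv ser_deriv]]) (rule wz_G_0)

section \<open>Bounds for the differentiated WZ pair\<close>

lemma quot_0: "quot f I g J 0 = ((\<Prod>i\<in>I. f i) / (\<Prod>j\<in>J. g j)) ^ 3"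
  by (simp add: quot_def cub_0 prod_power_distrib power_divide)

lemma sum_inverse_squares_le_card:
  fixes f :: "'a \<Rightarrow> real"
  assumes "finite I" "\<And>i. i \<in> I \<Longrightarrow> f i \<ge> 1"
  shows "(\<Sum>i\<in>I. 1 / (f i)^2) \<le> real (card I)"
proof -
  have "(\<Sum>i\<in>I. 1 / (f i)^2) \<le> (\<Sum>i\<in>I. 1)"
    using assms(2) by (intro sum_mono) (simp add: divide_le_eq_1 one_le_power)
  thus ?thesis by simp
qed

text \<open>Both sums of inverse squares lie between 0 and \<open>N\<close>, hence so does the
  absolute value of their difference. The lost factor is linear in \<open>m\<close> or
  \<open>n\<close> and does not grow with \<open>k\<close> in the uses below.\<close>

lemma abs_quot'_le:
  assumes "finite I" "\<And>i. i \<in> I \<Longrightarrow> f i \<ge> 1" "card I \<le> N"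
    and "finite J" "\<And>j. j \<in> J \<Longrightarrow> g j \<ge> 1" "card J \<le> N"
  shows "\<bar>quot' f I g J\<bar> \<le> real N * quot f I g J 0"
proof -
  define a where "a = (\<Sum>i\<in>I. 1 / (f i)^2)"
  define b where "b = (\<Sum>j\<in>J. 1 / (g j)^2)"
  have "0 \<le> a" "0 \<le> b" by (auto simp: a_def b_def sum_nonneg)
  moreover have "a \<le> N" "b \<le> N"
    using sum_inverse_squares_le_card[of I f] sum_inverse_squares_le_card[of J g] assms
    unfolding a_def b_def by force+
  ultimately have ab: "\<bar>b - a\<bar> \<le> N" by linarith
  have "f i \<ge> 0" if "i \<in> I" for i using assms(2)[OF that] by linarith
  moreover have "g j \<ge> 0" if "j \<in> J" for j using assms(5)[OF that] by linarith
  ultimately have "0 \<le> quot f I g J 0"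
    unfolding quot_0 by (intro zero_le_power divide_nonneg_nonneg prod_nonneg) auto
  with ab show ?thesis
    unfolding quot'_def a_def[symmetric] b_def[symmetric]
    by (simp add: abs_mult mult.commute[of _ "\<bar>b - a\<bar>"] mult_right_mono)
qed

lemma wz_quot_0_Suc:
  "wz_quot m a (Suc (a + m)) 0 =
   (\<Prod>j\<in>{1..m}. 2 * real j / (2 * real (a + j) + 1)) ^ 3 / (2 * real a + 1) ^ 3"
proof -
  have "(\<Prod>j\<in>{a..<Suc (a + n)}. 2 * real j + 1) =
        (2 * real a + 1) * (\<Prod>j\<in>{1..n}. 2 * real (a + j) + 1)" for n
    by (induction n) simp_all
  thus ?thesis
    by (simp only: wz_quot_def quot_0 prod_dividef power_divide power_mult_distrib)
       (simp add: field_simps)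
qed

text \<open>Since \<open>j \<le> m \<le> a\<close>, each ratio is at most 1/2, and cubing gives 1/8
  per factor.\<close>

lemma wz_quot_0_le:
  assumes "m \<le> a"
  shows "wz_quot m a (Suc (a + m)) 0 \<le> (1/8) ^ m / (2 * real a + 1) ^ 3"
proof -
  have "(\<Prod>j\<in>{1..m}. 2 * real j / (2 * real (a + j) + 1)) \<le> (\<Prod>j\<in>{1..m}. 1/2)"
    using assms by (intro prod_mono) (auto simp: field_simps)
  hence "(\<Prod>j\<in>{1..m}. 2 * real j / (2 * real (a + j) + 1)) ^ 3 \<le> ((1/2) ^ m) ^ 3"
    by (intro power_mono prod_nonneg) auto
  also have "\<dots> = (1/8) ^ m"
    by (simp add: power_mult[symmetric] mult.commute[of m]) (simp add: power_mult power3_eq_cube)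
  finally show ?thesis
    unfolding wz_quot_0_Suc by (intro divide_right_mono) auto
qed

lemma abs_wz_quot'_le:
  assumes "b \<le> a + m + 2"
  shows "\<bar>wz_quot' m a b\<bar> \<le> real (max m (b - a)) * wz_quot m a b 0"
  unfolding wz_quot'_def wz_quot_def by (intro abs_quot'_le) auto

text \<open>The rate 1/8 weakens to 1/4 because \<open>m + 1 \<le> 2 ^ m\<close>. The linear
  prefactor cancels one power of \<open>2 * a + 1\<close>, leaving a square that is summable over
  \<open>k\<close>.\<close>

lemma abs_wz_F'_le: "\<bar>wz_F' m k\<bar> \<le> 4 * (1/4) ^ m * (1 / (real k + 1) ^ 2)"
proof -
  define a where "a = m + k"
  have e: "2 * m + k + 1 = Suc (a + m)" by (simp add: a_def)
  have "real (m + 1) \<le> 2 ^ m"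
    using of_nat_mono[OF Suc_leI[OF less_exp[of m]], where 'a = real] by simp
  hence m: "real (m + 1) * (1/8) ^ m \<le> 2 ^ m * (1/8) ^ m"
    by (intro mult_right_mono) auto
  have m': "(2::real) ^ m * (1/8) ^ m = (1/4) ^ m"
    by (simp add: power_mult_distrib[symmetric])
  have "\<bar>wz_quot' m a (Suc (a + m))\<bar> \<le> real (m + 1) * wz_quot m a (Suc (a + m)) 0"
    using abs_wz_quot'_le[of "Suc (a + m)" a m] by (simp add: max_absorb2)
  also have "\<dots> \<le> real (m + 1) * ((1/8) ^ m / (2 * real a + 1) ^ 3)"
    by (intro mult_left_mono wz_quot_0_le) (auto simp: a_def)
  also have "\<dots> \<le> (1/4) ^ m / (2 * real a + 1) ^ 3"
    using m unfolding m' times_divide_eq_right by (intro divide_right_mono) auto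
  finally have q: "\<bar>wz_quot' m a (Suc (a + m))\<bar> \<le> (1/4) ^ m / (2 * real a + 1) ^ 3" .
  have "\<bar>wz_F' m k\<bar> = 2 * (1 + 3 * real m + 2 * real k) * \<bar>wz_quot' m a (Suc (a + m))\<bar>"
    unfolding wz_F'_def a_def[symmetric] e by (simp add: abs_mult)
  also have "\<dots> \<le> (4 * (2 * real a + 1)) * ((1/4) ^ m / (2 * real a + 1) ^ 3)"
    by (rule mult_mono[OF _ q]) (auto simp: a_def)
  also have "\<dots> = 4 * (1/4) ^ m * (1 / (2 * real a + 1) ^ 2)"
  proof -
    have "4 * x * (t / x ^ 3) = 4 * t * (1 / x ^ 2)" if "x \<noteq> 0" for x t :: real
      using that by (simp add: power3_eq_cube power2_eq_square)
    moreover have "2 * real a + 1 \<noteq> 0" using of_nat_0_le_iff[of a] by linarith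
    ultimately show ?thesis by blast
  qed
  also have "\<dots> \<le> 4 * (1/4) ^ m * (1 / (real k + 1) ^ 2)"
    by (intro mult_left_mono divide_left_mono power_mono) (auto simp: a_def)
  finally show ?thesis .
qed

text \<open>Needed only as \<open>k\<close> grows with \<open>m\<close> fixed. The certificate
  polynomials have nonnegative coefficients and degree at most 4 in \<open>k\<close>, so each is at
  most its value at 1 times \<open>c ^ 4\<close>, while the quotient is at most
  \<open>1 / c ^ 6\<close>.\<close>

lemma abs_wz_G'_le:
  "\<bar>wz_G' m k\<bar> \<le> (wz_N0 m 1 * (m + 2) + wz_N1 m 1) / (real k + 1) ^ 2"
proof -
  define a where "a = m + k"
  define c where "c = real k + 1"
  have e: "2 * m + k + 2 = Suc (Suc (a + m))" by (simp add: a_def)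
  have c1: "c \<ge> 1" by (simp add: c_def)
  have kc: "real k ^ i \<le> c ^ 4" if "i \<le> 4" for i
  proof -
    have "real k ^ i \<le> c ^ i" by (intro power_mono) (auto simp: c_def)
    also have "\<dots> \<le> c ^ 4" using that c1 by (intro power_increasing) auto
    finally show ?thesis .
  qed
  have k: "1 \<le> c ^ 4" "real k \<le> c ^ 4" "real k ^ 2 \<le> c ^ 4" "real k ^ 3 \<le> c ^ 4" "real k ^ 4 \<le> c ^ 4"
    using kc[of 0] kc[of 1] kc[of 2] kc[of 3] kc[of 4] by simp_all
  have x: "x \<le> x * c ^ 4" if "x \<ge> 0" for x :: real
    using mult_left_mono[OF k(1) that] by simp
  have N0: "wz_N0 m k \<le> wz_N0 m 1 * c ^ 4"
    unfolding wz_N0_def power_one mult_1_right distrib_right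
    by (intro add_mono mult_left_mono k x) auto
  have N1: "wz_N1 m k \<le> wz_N1 m 1 * c ^ 4"
    unfolding wz_N1_def power_one mult_1_right distrib_right
    by (intro add_mono mult_left_mono k x) auto
  have pos: "wz_N0 m x \<ge> 0" "wz_N1 m x \<ge> 0" if "x \<ge> 0" for x
    unfolding wz_N0_def wz_N1_def using that
    by (intro add_nonneg_nonneg mult_nonneg_nonneg zero_le_power; simp)+
  define q where "q = wz_quot m a (Suc (Suc (a + m))) 0"
  have "q = wz_quot m a (Suc (a + m)) 0 / (2 * real (Suc (a + m)) + 1) ^ 3"
    unfolding q_def using wz_quot_Suc_right[of a "Suc (a + m)" m 0] by (simp add: cub_0)
  \<comment> \<open>Only the first and last denominator factors are used for decay in
    \<open>k\<close>; the others, paired with the numerator, contribute at most 1.\<close>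
  also have "\<dots> \<le> (1 / c ^ 3) / c ^ 3"
  proof (intro frac_le)
    have "wz_quot m a (Suc (a + m)) 0 \<le> (1/8) ^ m / (2 * real a + 1) ^ 3"
      by (rule wz_quot_0_le) (simp add: a_def)
    also have "\<dots> \<le> 1 / c ^ 3"
      using c1 by (intro frac_le power_le_one power_mono) (auto simp: a_def c_def)
    finally show "wz_quot m a (Suc (a + m)) 0 \<le> 1 / c ^ 3" .
    show "c ^ 3 \<le> (2 * real (Suc (a + m)) + 1) ^ 3"
      using c1 by (intro power_mono) (auto simp: a_def c_def)
  qed (use c1 in auto)
  also have "\<dots> = 1 / c ^ 6" by (simp add: eval_nat_numeral)
  finally have q: "q \<le> 1 / c ^ 6" .
  have q0: "q \<ge> 0"
    unfolding q_def wz_quot_def quot_0 by (intro zero_le_power divide_nonneg_nonneg prod_nonneg) auto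
  have q': "\<bar>wz_quot' m a (Suc (Suc (a + m)))\<bar> \<le> (real m + 2) * q"
    using abs_wz_quot'_le[of "Suc (Suc (a + m))" a m] unfolding q_def
    by (simp add: max_absorb2 algebra_simps)
  have "\<bar>wz_G' m k\<bar> = \<bar>wz_N0 m k * wz_quot' m a (Suc (Suc (a + m))) - wz_N1 m k * q\<bar>"
    unfolding wz_G'_def a_def[symmetric] e q_def by (simp add: abs_mult)
  also have "\<dots> \<le> wz_N0 m k * \<bar>wz_quot' m a (Suc (Suc (a + m)))\<bar> + wz_N1 m k * q"
    using abs_triangle_ineq4[of "wz_N0 m k * wz_quot' m a (Suc (Suc (a + m)))" "wz_N1 m k * q"]
      pos[of k] q0
    by (simp add: abs_mult)
  also have "\<dots> \<le> wz_N0 m k * ((real m + 2) * q) + wz_N1 m k * q"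
    by (intro add_mono mult_left_mono q' pos order_refl) auto
  also have "\<dots> = (wz_N0 m k * (real m + 2) + wz_N1 m k) * q"
    by (simp add: algebra_simps)
  also have "\<dots> \<le> (wz_N0 m 1 * c ^ 4 * (real m + 2) + wz_N1 m 1 * c ^ 4) * (1 / c ^ 6)"
  proof (rule mult_mono[OF _ q])
    show "wz_N0 m k * (real m + 2) + wz_N1 m k \<le> wz_N0 m 1 * c ^ 4 * (real m + 2) + wz_N1 m 1 * c ^ 4"
      by (intro add_mono mult_right_mono N0 N1) auto
    show "0 \<le> wz_N0 m 1 * c ^ 4 * (real m + 2) + wz_N1 m 1 * c ^ 4"
      using c1 by (intro add_nonneg_nonneg mult_nonneg_nonneg pos) auto
  qed (rule q0)
  also have "\<dots> = (wz_N0 m 1 * (real m + 2) + wz_N1 m 1) * (c ^ 4 * (1 / c ^ 6))"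
    by (simp add: algebra_simps)
  also have "c ^ 4 * (1 / c ^ 6) = 1 / c ^ 2"
    using c1 by (simp add: field_simps flip: power_add)
  finally show ?thesis by (simp add: c_def add_ac)
qed

section \<open>Telescoping the differentiated pair\<close>

lemma inverse_Suc_square_tendsto_0: "(\<lambda>k. 1 / (real k + 1) ^ 2) \<longlonglongrightarrow> 0"
  using tendsto_power[OF LIMSEQ_inverse_real_of_nat, of 2]
  by (simp add: field_simps)

lemma wz_G'_tendsto_0: "wz_G' m \<longlonglongrightarrow> 0"
proof (rule Lim_null_comparison)
  show "\<forall>\<^sub>F k in sequentially.
      norm (wz_G' m k) \<le> (wz_N0 m 1 * (m + 2) + wz_N1 m 1) * (1 / (real k + 1) ^ 2)"
    using abs_wz_G'_le[of m] by simp
qed (rule tendsto_mult_right_zero[OF inverse_Suc_square_tendsto_0])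

lemma summable_inverse_Suc_square: "summable (\<lambda>k. 1 / (real k + 1) ^ 2)"
proof -
  have "summable (\<lambda>k. inverse (real (Suc k) ^ 2))"
    by (subst summable_Suc_iff, rule inverse_power_summable) simp
  thus ?thesis by (simp add: inverse_eq_divide add_ac)
qed

text \<open>\<open>e\<close> will be the remainder after \<open>m\<close> telescoping steps; the
  case \<open>m = 0\<close> also supplies convergence of the series for
  \<open>beta4\<close>.\<close>

lemma wz_F'_sums:
  obtains e where "wz_F' m sums e" "\<bar>e\<bar> \<le> 4 * (\<Sum>k. 1 / (real k + 1) ^ 2) * (1/4) ^ m"
proof
  have s: "summable (\<lambda>k. 4 * (1/4) ^ m * (1 / (real k + 1) ^ 2))"
    by (intro summable_mult summable_inverse_Suc_square)
  have s': "summable (\<lambda>k. \<bar>wz_F' m k\<bar>)"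
    by (rule summable_comparison_test'[OF s, of 0]) (use abs_wz_F'_le[of m] in simp)
  show "wz_F' m sums suminf (wz_F' m)"
    by (rule summable_sums[OF summable_rabs_cancel[OF s']])
  have "\<bar>suminf (wz_F' m)\<bar> \<le> (\<Sum>k. \<bar>wz_F' m k\<bar>)" by (rule summable_rabs[OF s'])
  also have "\<dots> \<le> (\<Sum>k. 4 * (1/4) ^ m * (1 / (real k + 1) ^ 2))"
    by (intro suminf_le abs_wz_F'_le s s')
  also have "\<dots> = 4 * (\<Sum>k. 1 / (real k + 1) ^ 2) * (1/4) ^ m"
    using suminf_mult[OF summable_inverse_Suc_square, of "4 * (1/4) ^ m"] by (simp only: mult_ac)
  finally show "\<bar>suminf (wz_F' m)\<bar> \<le> 4 * (\<Sum>k. 1 / (real k + 1) ^ 2) * (1/4) ^ m" .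
qed

text \<open>For \<open>m = 0\<close> the numerator range is empty and the denominator range is the
  single index \<open>k\<close>.\<close>

lemma wz_F'_0: "wz_F' 0 k = 2 * ((-1)^k / (1 + 2 * real k) ^ 4)"
proof -
  define x where "x = 1 + 2 * real k"
  have "x \<noteq> 0" using of_nat_0_le_iff[of k] unfolding x_def by linarith
  hence "2 * (-1)^k * x * ((1 / x) ^ 3 * (1 / x ^ 2)) = 2 * ((-1)^k / x ^ 4)"
    by (simp add: field_simps eval_nat_numeral)
  moreover have "wz_F' 0 k = 2 * (-1)^k * x * ((1 / x) ^ 3 * (1 / x ^ 2))"
    unfolding wz_F'_def wz_quot'_def quot'_def quot_0 x_def by (simp add: add.commute)
  ultimately show ?thesis by (simp only: x_def)
qed

lemma wz_F'_0_sums: "wz_F' 0 sums (2 * beta4)"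
proof -
  obtain e where e: "wz_F' 0 sums e" by (rule wz_F'_sums)
  hence "summable (\<lambda>k. 2 * ((-1)^k / (1 + 2 * real k) ^ 4))"
    by (simp add: wz_F'_0 [abs_def] sums_iff)
  hence "summable (\<lambda>k. (-1)^k / (1 + 2 * real k) ^ 4)"
    by (simp only: summable_cmult_iff) simp
  thus ?thesis
    unfolding wz_F'_0[abs_def] beta4_def by (intro sums_mult summable_sums)
qed

text \<open>Telescoping over \<open>k\<close> leaves \<open>wz_G' m 0\<close>, as
  \<open>wz_G' m\<close> vanishes at infinity; telescoping over \<open>m\<close> is finite, so only
  a finite sum is exchanged with a series.\<close>

lemma wz_F'_diff_sums: "(\<lambda>k. wz_F' 0 k - wz_F' M k) sums (\<Sum>m<M. wz_G' m 0)"
proof -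
  have "(\<lambda>k. wz_F' m k - wz_F' (Suc m) k) sums wz_G' m 0" for m
    using telescope_sums'[OF wz_G'_tendsto_0[of m]] by (simp add: wz_pair')
  hence "(\<lambda>k. \<Sum>m<M. wz_F' m k - wz_F' (Suc m) k) sums (\<Sum>m<M. wz_G' m 0)"
    by (intro sums_sum)
  moreover have "(\<Sum>m<M. wz_F' m k - wz_F' (Suc m) k) = wz_F' 0 k - wz_F' M k" for k
    by (rule sum_lessThan_telescope')
  ultimately show ?thesis by simp
qed

lemma sum_wz_G'_0: "(\<Sum>m<M. wz_G' m 0) = (\<Sum>n<2*M. ser' n)"
  by (induction M) (simp_all add: wz_G'_0)

text \<open>Each \<open>wz_G' m 0\<close> supplies two consecutive terms, so \<open>M\<close> steps
  reach exactly the partial sum of length \<open>2 * M\<close>, and the error is the geometrically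
  small \<open>e\<close>.\<close>

lemma even_partial_sums_tendsto: "(\<lambda>M. \<Sum>n<2*M. ser' n) \<longlonglongrightarrow> 2 * beta4"
proof -
  let ?S = "\<Sum>k. 1 / (real k + 1) ^ 2"
  have "norm ((\<Sum>n<2*M. ser' n) - 2 * beta4) \<le> 4 * ?S * (1/4) ^ M" for M
  proof -
    obtain e where e: "wz_F' M sums e" "\<bar>e\<bar> \<le> 4 * ?S * (1/4) ^ M" by (rule wz_F'_sums)
    have "2 * beta4 - e = (\<Sum>m<M. wz_G' m 0)"
      using sums_unique2[OF sums_diff[OF wz_F'_0_sums e(1)] wz_F'_diff_sums] .
    with e(2) show ?thesis by (simp add: sum_wz_G'_0)
  qed
  moreover have "(\<lambda>M. 4 * ?S * (1/4) ^ M) \<longlonglongrightarrow> 0"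
    by (intro tendsto_mult_right_zero LIMSEQ_power_zero) simp
  ultimately have "(\<lambda>M. (\<Sum>n<2*M. ser' n) - 2 * beta4) \<longlonglongrightarrow> 0"
    by (rule Lim_null_comparison[OF always_eventually, OF allI])
  thus ?thesis by (simp add: LIM_zero_iff)
qed

section \<open>Shifted factorials, harmonic numbers and the final sum\<close>

lemma prod_odd_atMost:
  "(\<Prod>j\<le>n. 2 * real j + 1) = 2 ^ n * pochhammer (3/2) n"
  by (induction n) (simp_all add: pochhammer_Suc field_simps)

lemma prod_real_eq_pochhammer: "(\<Prod>j\<in>{1..n}. real j) = pochhammer 1 n"
  by (simp add: pochhammer_fact[symmetric] fact_prod)

text \<open>Even denominators contribute a quarter of \<open>harm2 n\<close>. Subtracting
  \<open>5/4 * harm2 n\<close> therefore leaves the odd sum minus \<open>harm2 n\<close>, the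
  difference occurring in \<open>quot'\<close>.\<close>

lemma harm2_odd: "harm2 (1 + 2 * n) = (\<Sum>j\<le>n. 1 / (2 * real j + 1)^2) + harm2 n / 4"
proof (induction n)
  case (Suc n)
  have "1 / (2 * real n + 2)^2 = 1 / (real n + 1)^2 / 4"
    by (simp add: power2_eq_square field_simps)
  with Suc show ?case by (simp add: harm2_def add_ac add_divide_distrib)
qed (simp add: harm2_def)

lemma ser'_eq:
  "ser' k = (2 + 3 * real k) / (-8)^k
            * ((pochhammer 1 k)^3 / (pochhammer (3/2) k)^3)
            * (harm2 (1 + 2 * k) - 5/4 * harm2 k)"
proof -
  have p: "(2 ^ k) ^ 3 = (8::real) ^ k"
    by (simp add: power_mult[symmetric] mult.commute[of k]) (simp add: power_mult)
  have 8: "(-1) ^ k / (8::real) ^ k = 1 / (-8) ^ k"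
    by (simp add: power_minus[of 8] field_simps)
  have "quot real {1..k} (\<lambda>j. 2 * real j + 1) {..k} 0 =
      pochhammer 1 k ^ 3 / pochhammer (3/2) k ^ 3 / 8 ^ k"
    unfolding quot_0 prod_odd_atMost prod_real_eq_pochhammer
    by (simp add: power_divide power_mult_distrib p)
  moreover have "(\<Sum>j\<le>k. 1 / (2 * real j + 1)^2) - (\<Sum>j\<in>{1..k}. 1 / (real j)^2)
      = harm2 (1 + 2 * k) - 5/4 * harm2 k"
    unfolding harm2_odd by (simp add: harm2_def)
  ultimately have "ser' k = (3 * real k + 2) * ((-1) ^ k / 8 ^ k) *
      (pochhammer 1 k ^ 3 / pochhammer (3/2) k ^ 3) * (harm2 (1 + 2 * k) - 5/4 * harm2 k)"
    unfolding ser'_def quot'_def by (simp add: mult_ac)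
  thus ?thesis unfolding 8 by (simp add: add.commute)
qed

text \<open>Supplies the summability that even partial sums alone do not give. The cubed ratios
  decay like \<open>(1/8)^n\<close>, and each of the two linear factors costs at most a multiple of
  \<open>2 ^ n\<close>.\<close>

lemma abs_ser'_le: "\<bar>ser' n\<bar> \<le> 3 * (1/2) ^ n"
proof -
  \<comment> \<open>The factor at \<open>j = 0\<close> is 1; dropping it matches the index range of
    the numerator.\<close>
  have "(\<Prod>j\<le>n. 2 * real j + 1) = (\<Prod>j\<in>{1..n}. 2 * real j + 1)"
    by (simp add: atMost_atLeast0 prod.atLeast_Suc_atMost)
  hence "(\<Prod>j\<in>{1..n}. real j) / (\<Prod>j\<le>n. 2 * real j + 1) = (\<Prod>j\<in>{1..n}. real j / (2 * real j + 1))"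
    by (simp add: prod_dividef)
  also have "\<dots> \<le> (\<Prod>j\<in>{1..n}. 1/2)"
    by (intro prod_mono) (auto simp: field_simps)
  finally have "((\<Prod>j\<in>{1..n}. real j) / (\<Prod>j\<le>n. 2 * real j + 1)) ^ 3 \<le> ((1/2) ^ n) ^ 3"
    by (intro power_mono divide_nonneg_nonneg prod_nonneg) auto
  also have "((1/2::real) ^ n) ^ 3 = (1/8) ^ n"
    by (simp add: power_mult[symmetric] mult.commute[of n]) (simp add: power_mult power3_eq_cube)
  finally have q: "quot real {1..n} (\<lambda>j. 2 * real j + 1) {..n} 0 \<le> (1/8) ^ n"
    unfolding quot_0 .
  have n: "real n + 1 \<le> 2 ^ n"
    using of_nat_mono[OF Suc_leI[OF less_exp[of n]], where 'a = real] by simp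
  have "\<bar>quot' real {1..n} (\<lambda>j. 2 * real j + 1) {..n}\<bar>
      \<le> real (Suc n) * quot real {1..n} (\<lambda>j. 2 * real j + 1) {..n} 0"
    by (intro abs_quot'_le) auto
  also have "\<dots> \<le> 2 ^ n * (1/8) ^ n"
    using n by (intro mult_mono q) (auto simp: quot_0 intro!: divide_nonneg_nonneg prod_nonneg)
  finally have q': "\<bar>quot' real {1..n} (\<lambda>j. 2 * real j + 1) {..n}\<bar> \<le> 2 ^ n * (1/8) ^ n" .
  have "\<bar>ser' n\<bar> = (3 * real n + 2) * \<bar>quot' real {1..n} (\<lambda>j. 2 * real j + 1) {..n}\<bar>"
    by (simp add: ser'_def abs_mult)
  also have "\<dots> \<le> (3 * 2 ^ n) * (2 ^ n * (1/8) ^ n)"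
    using n by (intro mult_mono q') auto
  also have "\<dots> = 3 * (1/2) ^ n"
    by (simp add: power_mult_distrib[symmetric])
  finally show ?thesis .
qed

text \<open>Summability makes the whole series converge to the limit already found along even
  partial sums.\<close>

lemma ser'_sums: "ser' sums (2 * beta4)"
proof -
  have "summable ser'"
    by (rule summable_comparison_test'[of "\<lambda>n. 3 * (1/2) ^ n" 0])
       (use abs_ser'_le in \<open>auto intro!: summable_mult summable_geometric\<close>)
  hence s: "ser' sums suminf ser'" by (rule summable_sums)
  have "(\<lambda>M. \<Sum>n<2*M. ser' n) \<longlonglongrightarrow> suminf ser'"
    using LIMSEQ_subseq_LIMSEQ[OF s[unfolded sums_def], of "\<lambda>M. 2 * M"]
    by (simp add: strict_mono_def o_def)
  with even_partial_sums_tendsto have "suminf ser' = 2 * beta4" by (metis LIMSEQ_unique)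
  with s show ?thesis by simp
qed

theorem theorem1p1:
  shows "(\<lambda>k. (2 + 3 * real k) / (-8)^k
            * ((pochhammer 1 k)^3 / (pochhammer (3/2) k)^3)
            * (harm2 (1 + 2 * k) - 5/4 * harm2 k))
         sums (2 * beta4)"
  using ser'_sums unfolding ser'_eq[abs_def] .

end
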